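(* Let $d\ge1$ be an integer. For all Borel subsets $A,B\subset[0,1]^d$, the set $A\,\square\,B$ is Lebesgue measurable and $$\lambda_d(A\,\square\,B)\le m_d(A)\,m_d(B).$$
   Context: Write $[d]=\{1,\dots,d\}$ and $S=[0,1]$. For $\omega\in S^d$ and $K\subset[d]$, let $\mathrm{Cyl}(K,\omega)=\{\overline\omega\in S^d:\overline\omega_i=\omega_i\text{ for all }i\in K\}$. For $A\subset S^d$ let $[A]_K=\{\omega\in S^d:\mathrm{Cyl}(K,\omega)\subset A\}$. The BKR operator is defined, for $A,B\subset S^d$, by $A\,\square\,B=\bigcup_{K\subset[d]}[A]_K\cap[B]_{[d]\setminus K}$. $m_d$ denotes Lebesgue measure on the Borel sigma-algebra of $[0,1]^d$, and $\lambda_d$ denotes its completion, i.e. Lebesgue measure on the Lebesgue measurable subsets of $[0,1]^d$. *)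

theory Defs
  imports "HOL-Analysis.Analysis"
begin

text \<open>
  The index set $\{1,\dots,d\}$ is an arbitrary finite type \<open>'n\<close>, so $d$ is \<open>CARD('n)\<close>
  and \<open>d \<ge> 1\<close> holds because types are nonempty. The complement \<open>- K\<close> is taken in \<open>'n\<close>.
\<close>

definition unit_cube :: "(real ^ 'n) set" where
  "unit_cube = {x. \<forall>i. x $ i \<in> {0..1}}"

definition cyl :: "'n set \<Rightarrow> real ^ 'n \<Rightarrow> (real ^ 'n) set" where
  "cyl K w = {v \<in> unit_cube. \<forall>i\<in>K. v $ i = w $ i}"

definition cyl_part :: "'n set \<Rightarrow> (real ^ 'n) set \<Rightarrow> (real ^ 'n) set" where
  "cyl_part K A = {w \<in> unit_cube. cyl K w \<subseteq> A}"

definition bkr :: "(real ^ 'n) set \<Rightarrow> (real ^ 'n) set \<Rightarrow> (real ^ 'n) set"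
    (infixl "\<box>" 70) where
  "A \<box> B = (\<Union>K. cyl_part K A \<inter> cyl_part (- K) B)"

text \<open>
  Since \<open>lborel\<close> lives on the Borel sets, \<open>cube_borel\<close> has exactly the Borel subsets of the cube
  as its measurable sets; those of \<open>cube_lebesgue\<close> are the Lebesgue measurable subsets.
\<close>

definition cube_borel :: "(real ^ 'n) measure" where
  "cube_borel = restrict_space lborel unit_cube"

definition cube_lebesgue :: "(real ^ 'n) measure" where
  "cube_lebesgue = completion cube_borel"

end

theory Submission
  imports Defs
begin

text \<open>
  For the uniform measure on $\{0,1\}^I$, Reimer's inequality
  $|A \mathbin{\square} B| \le |\{z \in A : z \mathbin{\triangle} M \in B\}|$ for every $M \subseteq I$
  follows from a rank argument with integer tensors, and summing it over $M$ gives the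
  BKR inequality $2^{|I|} |A \mathbin{\square} B| \le |A| |B|$. Dyadic discretisation with binary
  digits as coordinates turns this into the inequality for finite unions of closed cylinders in the
  cube. For Borel $A$, the complement of $[A]_K$ is a projection of a Borel set, hence Lebesgue
  measurable, and closed subsets of $[A]_K$ approximating it in measure may be replaced by their
  $K$-saturations, which are closed cylinders still contained in $[A]_K$.
\<close>

section \<open>The BKR inequality on finite cubes\<close>

text \<open>The box operation is unstable under null sets: deleting the diagonal from the unit
  square empties [A]_K for every K except the whole index set. So A and B cannot themselves be
  replaced by nearby simple sets; the approximation is carried out inside each of the finitely many
  sets [A]_K and [B]_{-K}, and only from within. These sets are coanalytic and in general not Borel,
  which is why the completed measure appears and why projections have to be studied.

  The vocabulary of the finite part is that of Reimer's butterflies: a point x is the body, its red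
  wing is the cylinder fixed on \<open>K x\<close>, its yellow wing the one fixed off
  \<open>K x\<close>, here reflected along M. Leaving M free, with unit vectors in the coordinates
  outside M, gives the inequality for all subcubes at once. Integer coefficients are essential:
  independence of the body tensors is proved by reduction modulo 2, where the choice of wings
  becomes invisible.\<close>

lemma sum_Pow_prod:
  fixes f :: "'a \<Rightarrow> bool \<Rightarrow> 'b::comm_semiring_1"
  assumes "finite I"
  shows "(\<Sum>z\<in>Pow I. \<Prod>i\<in>I. f i (i \<in> z)) = (\<Prod>i\<in>I. f i True + f i False)"
  using assms
proof (induction I)
  case empty
  then show ?case by simp
next
  case (insert j I)
  have disj: "Pow I \<inter> insert j ` Pow I = {}"
    using insert.hyps by auto
  have inj: "inj_on (insert j) (Pow I)"
    using insert.hyps by (auto simp: inj_on_def)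
  have on: "(\<Prod>i\<in>insert j I. f i (i \<in> insert j z)) = f j True * (\<Prod>i\<in>I. f i (i \<in> z))" for z
  proof -
    have "(\<Prod>i\<in>I. f i (i \<in> insert j z)) = (\<Prod>i\<in>I. f i (i \<in> z))"
      using insert.hyps by (intro prod.cong) (auto intro!: arg_cong[where f = "f _"])
    then show ?thesis using insert.hyps by simp
  qed
  have off: "(\<Prod>i\<in>insert j I. f i (i \<in> z)) = f j False * (\<Prod>i\<in>I. f i (i \<in> z))"
    if "z \<in> Pow I" for z
  proof -
    have "j \<notin> z" using that insert.hyps by auto
    then show ?thesis using insert.hyps by simp
  qed
  have "(\<Sum>z\<in>Pow (insert j I). \<Prod>i\<in>insert j I. f i (i \<in> z)) =
      (\<Sum>z\<in>Pow I. f j False * (\<Prod>i\<in>I. f i (i \<in> z))) +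
      (\<Sum>z\<in>Pow I. f j True * (\<Prod>i\<in>I. f i (i \<in> z)))"
    unfolding Pow_insert using insert.hyps disj
    by (subst sum.union_disjoint) (simp_all only: sum.reindex[OF inj] o_def on off
        finite_Pow_iff finite_imageI cong: sum.cong)
  also have "\<dots> = f j False * (\<Prod>i\<in>I. f i True + f i False) + f j True * (\<Prod>i\<in>I. f i True + f i False)"
    unfolding insert.IH[symmetric] by (simp only: sum_distrib_left)
  also have "\<dots> = (\<Prod>i\<in>insert j I. f i True + f i False)"
    using insert.hyps by (simp add: distrib_right add.commute)
  finally show ?case .
qed

text \<open>Fraction-free Gaussian elimination: a pivot \<open>m y t\<close> removes the equation
  \<open>t\<close> by cross-multiplication, so the solution stays integral, as the later
  divisibility argument needs.\<close>

lemma integer_kernel_nontrivial: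
  fixes m :: "'s \<Rightarrow> 't \<Rightarrow> int"
  assumes "finite T" "finite S" "card T < card S"
  shows "\<exists>c. (\<exists>x\<in>S. c x \<noteq> 0) \<and> (\<forall>t\<in>T. (\<Sum>x\<in>S. c x * m x t) = 0)"
  using assms
proof (induction T arbitrary: S m rule: finite_induct)
  case empty
  then have "S \<noteq> {}" by auto
  then show ?case by (intro exI[of _ "\<lambda>_. 1"]) auto
next
  case (insert t T)
  show ?case
  proof (cases "\<forall>x\<in>S. m x t = 0")
    case True
    moreover have "card T < card S"
      using insert by simp
    ultimately show ?thesis
      using insert.IH[of S m] insert.prems by auto
  next
    case False
    then obtain y where y: "y \<in> S" "m y t \<noteq> 0" by auto
    define S' where "S' = S - {y}"
    have S': "finite S'" "S = insert y S'" "y \<notin> S'"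
      using y insert.prems by (auto simp: S'_def)
    have "card T < card S'"
      using insert.prems insert.hyps S' by simp
    then obtain c where c: "\<exists>x\<in>S'. c x \<noteq> 0"
      and c0: "\<And>s. s \<in> T \<Longrightarrow> (\<Sum>x\<in>S'. c x * (m y t * m x s - m x t * m y s)) = 0"
      using insert.IH[of S' "\<lambda>x s. m y t * m x s - m x t * m y s"] S' by blast
    \<comment> \<open>Back substitution: the other coefficients are scaled by the pivot, and the one
      at \<open>y\<close> is chosen to cancel the equation \<open>t\<close>.\<close>
    define e where "e = (\<lambda>x. if x = y then - (\<Sum>x\<in>S'. c x * m x t) else m y t * c x)"
    have e: "(\<Sum>x\<in>S. e x * m x s) =
        (\<Sum>x\<in>S'. c x * (m y t * m x s - m x t * m y s))" for s
    proof -
      have "(\<Sum>x\<in>S'. e x * m x s) = (\<Sum>x\<in>S'. m y t * c x * m x s)"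
        using S' by (intro sum.cong) (auto simp: e_def)
      moreover have "e y * m y s = - (\<Sum>x\<in>S'. c x * m x t * m y s)"
        by (simp add: e_def sum_distrib_right)
      ultimately show ?thesis
        using S' by (simp add: sum_subtractf algebra_simps)
    qed
    obtain x where "x \<in> S'" "c x \<noteq> 0" using c by auto
    then have "x \<in> S" "e x \<noteq> 0"
      using S' y by (auto simp: e_def)
    then have "\<exists>x\<in>S. e x \<noteq> 0" by auto
    moreover have "(\<Sum>x\<in>S. e x * m x t) = 0"
      by (simp add: e mult.commute)
    ultimately show ?thesis
      using c0 by (intro exI[of _ e]) (auto simp: e)
  qed
qed

text \<open>
  Vectors in the plane list the value at \<open>False\<close> first.
  In one coordinate, a point with entry \<open>x\<close> and wing bit \<open>k\<close> has the body vector
  $(1,0)$, $(0,1)$ (for \<open>x = False\<close>, \<open>k = True, False\<close>) or $(1,1)$, $(1,-1)$ (for \<open>x = True\<close>):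
  two orthogonal bases of the plane. With $P = ((1,-1),(0,1))$, the red vector is $P$ and the
  yellow one $P^{-T}$ applied to it, so that their inner products are those of the body vectors,
  while $P$ makes red a unit vector at \<open>x\<close> when \<open>k\<close> holds, and yellow one at the flipped entry
  when it does not. Outside the set \<open>M\<close> of flipped coordinates all three are unit vectors at \<open>x\<close>.
\<close>

definition red :: "bool \<Rightarrow> bool \<Rightarrow> bool \<Rightarrow> bool \<Rightarrow> int" where
  "red m x k z = (if \<not> m \<or> k then of_bool (z = x)
     else if x then (if z then -1 else 2) else (if z then 1 else -1))"

definition yellow :: "bool \<Rightarrow> bool \<Rightarrow> bool \<Rightarrow> bool \<Rightarrow> int" where
  "yellow m x k z = (if \<not> m then of_bool (z = x) else if \<not> k then of_bool (z \<noteq> x)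
     else if x \<and> z then 2 else 1)"

definition body :: "bool \<Rightarrow> bool \<Rightarrow> bool \<Rightarrow> bool \<Rightarrow> int" where
  "body m x k z = (if \<not> m then of_bool (z = x)
     else if x then (if z \<and> \<not> k then -1 else 1) else of_bool (z \<noteq> k))"

text \<open>
  Modulo 2 the vectors $(1,1)$ and $(1,-1)$ agree, and modulo them so do $(1,0)$ and $(0,1)$;
  hence the tensor products of body vectors are unitriangular modulo 2, whatever the wing bits.
\<close>

definition dual :: "bool \<Rightarrow> bool \<Rightarrow> bool \<Rightarrow> int" where
  "dual m y z = (if m \<and> \<not> y then 1 else of_bool (z = y))"

lemma red_yellow_gram:
  "red m x k True * yellow m x' k' True + red m x k False * yellow m x' k' False =
   body m x k True * body m x' k' True + body m x k False * body m x' k' False"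
  by (cases m; cases x; cases k; cases x'; cases k') (simp_all add: red_def yellow_def body_def)

lemma dual_body_diag:
  "odd (dual m x True * body m x k True + dual m x False * body m x k False)"
  by (cases m; cases x; cases k) (simp_all add: dual_def body_def)

lemma dual_body_upper:
  "even (dual m False True * body m True k True + dual m False False * body m True k False)"
  by (cases m; cases k) (simp_all add: dual_def body_def)

section \<open>Independence of the body tensors and Reimer's inequality\<close>

definition tensor :: "'a set \<Rightarrow> ('a \<Rightarrow> bool \<Rightarrow> int) \<Rightarrow> 'a set \<Rightarrow> int" where
  "tensor I f z = (\<Prod>i\<in>I. f i (i \<in> z))"

lemma sum_tensor_mult:
  assumes "finite I"
  shows "(\<Sum>z\<in>Pow I. tensor I f z * tensor I g z) =
    (\<Prod>i\<in>I. f i True * g i True + f i False * g i False)"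
  using sum_Pow_prod[OF assms, of "\<lambda>i b. f i b * g i b"]
  by (simp add: tensor_def prod.distrib)

abbreviation body_vecs :: "'a set \<Rightarrow> 'a set \<Rightarrow> ('a set \<Rightarrow> 'a set) \<Rightarrow> 'a set \<Rightarrow> 'a set \<Rightarrow> int" where
  "body_vecs I M K x \<equiv> tensor I (\<lambda>i. body (i \<in> M) (i \<in> x) (i \<in> K x))"

text \<open>Pair the relation with the dual tensor at \<open>y\<close>. The pairing is odd with the
  body tensor at \<open>y\<close> and even with the one at any \<open>x\<close> not contained in
  \<open>y\<close>, since a coordinate in \<open>x\<close> but not in \<open>y\<close> contributes
  an even factor. The remaining \<open>x\<close> are proper subsets of \<open>y\<close>, whose
  coefficients are even by induction on the cardinality.\<close>

lemma body_vecs_relation_even: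
  fixes c :: "'a set \<Rightarrow> int"
  assumes I: "finite I" and S: "S \<subseteq> Pow I"
    and rel: "\<And>z. z \<in> Pow I \<Longrightarrow> (\<Sum>x\<in>S. c x * body_vecs I M K x z) = 0"
    and "y \<in> S"
  shows "even (c y)"
  using \<open>y \<in> S\<close>
proof (induction "card y" arbitrary: y rule: less_induct)
  case less
  have fS: "finite S" using I S by (auto intro: finite_subset)
  define p where "p = (\<lambda>x. \<Prod>i\<in>I.
     dual (i \<in> M) (i \<in> y) True * body (i \<in> M) (i \<in> x) (i \<in> K x) True +
     dual (i \<in> M) (i \<in> y) False * body (i \<in> M) (i \<in> x) (i \<in> K x) False)"
  have "(\<Sum>x\<in>S. c x * p x) =
      (\<Sum>x\<in>S. \<Sum>z\<in>Pow I. c x * (tensor I (\<lambda>i. dual (i \<in> M) (i \<in> y)) z * body_vecs I M K x z))"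
    by (simp add: p_def sum_tensor_mult[OF I] flip: sum_distrib_left)
  also have "\<dots> = (\<Sum>z\<in>Pow I. tensor I (\<lambda>i. dual (i \<in> M) (i \<in> y)) z *
      (\<Sum>x\<in>S. c x * body_vecs I M K x z))"
    by (subst sum.swap) (simp add: sum_distrib_left mult.left_commute)
  also have "\<dots> = 0" by (simp add: rel)
  finally have "c y * p y + (\<Sum>x\<in>S-{y}. c x * p x) = 0"
    using less.prems fS by (simp add: sum.remove)
  moreover have "even (\<Sum>x\<in>S-{y}. c x * p x)"
  proof (rule dvd_sum)
    fix x assume x: "x \<in> S - {y}"
    show "even (c x * p x)"
    proof (cases "x \<subseteq> y")
      case True
      then have "x \<subset> y" using x by auto
      moreover have "finite y" using I S less.prems by (auto intro: finite_subset)
      ultimately show ?thesis using less.hyps[of x] x psubset_card_mono by auto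
    next
      case False
      then obtain i where "i \<in> x" "i \<notin> y" by auto
      moreover have "i \<in> I" using x S \<open>i \<in> x\<close> by auto
      ultimately have "even (p x)"
        unfolding p_def
        using dual_body_upper[of "i \<in> M" "i \<in> K x"] \<open>i \<in> x\<close> \<open>i \<notin> y\<close>
        by (subst even_prod_iff[OF I]) (intro bexI[of _ i], simp_all only: simp_thms)
      then show ?thesis by simp
    qed
  qed
  moreover have "odd (p y)"
    unfolding p_def even_prod_iff[OF I] by (blast dest: dual_body_diag[THEN notE])
  ultimately show ?case
    by (metis even_add even_mult_iff even_zero)
qed

text \<open>Descent: an even relation can be halved and is again a relation, so every power of 2
  divides each coefficient, which forces it to be 0.\<close>

lemma body_vecs_independent:
  fixes c :: "'a set \<Rightarrow> int"
  assumes I: "finite I" and S: "S \<subseteq> Pow I"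
    and rel: "\<And>z. z \<in> Pow I \<Longrightarrow> (\<Sum>x\<in>S. c x * body_vecs I M K x z) = 0"
    and y: "y \<in> S"
  shows "c y = 0"
proof -
  have "2 ^ n dvd c y" for n
    using rel
  proof (induction n arbitrary: c)
    case (Suc n)
    have ev: "c x = 2 * (c x div 2)" if "x \<in> S" for x
      using body_vecs_relation_even[OF I S Suc.prems that] by simp
    have "(\<Sum>x\<in>S. c x div 2 * body_vecs I M K x z) = 0" if "z \<in> Pow I" for z
    proof -
      have "2 * (\<Sum>x\<in>S. c x div 2 * body_vecs I M K x z) = (\<Sum>x\<in>S. c x * body_vecs I M K x z)"
        unfolding sum_distrib_left
      proof (intro sum.cong refl)
        fix x assume "x \<in> S"
        then show "2 * (c x div 2 * body_vecs I M K x z) = c x * body_vecs I M K x z"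
          by (subst (2) ev) simp_all
      qed
      then show ?thesis using Suc.prems[OF that] by simp
    qed
    then have "2 ^ n dvd c y div 2" by (rule Suc.IH)
    then show ?case using ev[OF y] by (metis mult_dvd_mono dvd_refl power_Suc)
  qed simp
  then have "\<bar>c y\<bar> < 2 ^ nat \<bar>c y\<bar> \<Longrightarrow> ?thesis"
    using dvd_imp_le_int[of "c y" "2 ^ nat \<bar>c y\<bar>"] by (cases "c y = 0") auto
  moreover have "\<bar>c y\<bar> < 2 ^ nat \<bar>c y\<bar>"
    by (metis abs_ge_zero less_exp nat_0_le of_nat_less_iff of_nat_numeral of_nat_power)
  ultimately show ?thesis by simp
qed

text \<open>
  The right-hand side counts the points which can support both a red and a yellow tensor, so it
  bounds the rank of their matrix of inner products, which is a nonsingular Gram matrix.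
\<close>

lemma reimer_flock:
  assumes I: "finite I" and S: "S \<subseteq> Pow I"
  shows "card S \<le> card {z \<in> Pow I. (\<exists>x\<in>S. z \<inter> K x = x \<inter> K x) \<and>
    (\<exists>x\<in>S. \<forall>i\<in>I - K x. i \<in> z \<longleftrightarrow> (i \<in> x) \<noteq> (i \<in> M))}"
    (is "_ \<le> card ?Z")
proof (rule ccontr)
  assume "\<not> ?thesis"
  moreover have fS: "finite S" using I S by (auto intro: finite_subset)
  moreover have "finite ?Z" using I by simp
  ultimately obtain c where c: "\<exists>x\<in>S. c x \<noteq> 0" and rel: "\<And>z. z \<in> ?Z \<Longrightarrow>
      (\<Sum>x\<in>S. c x * tensor I (\<lambda>i. red (i \<in> M) (i \<in> x) (i \<in> K x)) z) = 0"
    using integer_kernel_nontrivial[of ?Z S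
        "\<lambda>x. tensor I (\<lambda>i. red (i \<in> M) (i \<in> x) (i \<in> K x))"] by auto
  define a where "a = (\<lambda>x. tensor I (\<lambda>i. red (i \<in> M) (i \<in> x) (i \<in> K x)))"
  define b where "b = (\<lambda>x. tensor I (\<lambda>i. yellow (i \<in> M) (i \<in> x) (i \<in> K x)))"
  define g where "g = body_vecs I M K"
  have supp_a: "z \<inter> K x = x \<inter> K x" if "a x z \<noteq> 0" "z \<in> Pow I" "x \<in> S" for x z
  proof -
    have "red (i \<in> M) (i \<in> x) (i \<in> K x) (i \<in> z) \<noteq> 0" if "i \<in> I" for i
      using \<open>a x z \<noteq> 0\<close> that I by (auto simp: a_def tensor_def)
    then have "i \<in> z \<longleftrightarrow> i \<in> x" if "i \<in> I" "i \<in> K x" for i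
      using that by (fastforce simp: red_def split: if_splits)
    then show ?thesis using that S by auto
  qed
  have supp_b: "\<forall>i\<in>I - K x. i \<in> z \<longleftrightarrow> (i \<in> x) \<noteq> (i \<in> M)" if "b x z \<noteq> 0" for x z
  proof -
    have "yellow (i \<in> M) (i \<in> x) (i \<in> K x) (i \<in> z) \<noteq> 0" if "i \<in> I" for i
      using \<open>b x z \<noteq> 0\<close> that I by (auto simp: b_def tensor_def)
    then show ?thesis
      by (fastforce simp: yellow_def split: if_splits)
  qed
  have gram: "(\<Sum>z\<in>Pow I. a x z * b y z) = (\<Sum>z\<in>Pow I. g x z * g y z)" for x y
    by (simp add: a_def b_def g_def sum_tensor_mult[OF I] red_yellow_gram)
  \<comment> \<open>By the Gram identity it suffices to pair the red combination with the yellow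
    tensor of \<open>y\<close>. At points of \<open>?Z\<close> the combination vanishes by the
    choice of \<open>c\<close>; at any other point either this yellow tensor or every red one is
    0.\<close>
  have "(\<Sum>z\<in>Pow I. (\<Sum>x\<in>S. c x * g x z) * g y z) = 0" if "y \<in> S" for y
  proof -
    have "(\<Sum>z\<in>Pow I. (\<Sum>x\<in>S. c x * g x z) * g y z) =
        (\<Sum>x\<in>S. c x * (\<Sum>z\<in>Pow I. g x z * g y z))"
      unfolding sum_distrib_left sum_distrib_right by (subst sum.swap) (simp add: mult_ac)
    also have "\<dots> = (\<Sum>x\<in>S. c x * (\<Sum>z\<in>Pow I. a x z * b y z))"
      by (simp add: gram)
    also have "\<dots> = (\<Sum>z\<in>Pow I. (\<Sum>x\<in>S. c x * a x z) * b y z)"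
      unfolding sum_distrib_left sum_distrib_right by (subst sum.swap) (simp add: mult_ac)
    also have "\<dots> = 0"
    proof (intro sum.neutral ballI)
      fix z assume z: "z \<in> Pow I"
      show "(\<Sum>x\<in>S. c x * a x z) * b y z = 0"
      proof (cases "b y z = 0 \<or> (\<forall>x\<in>S. a x z = 0)")
        case False
        then have "z \<in> ?Z" using z supp_a supp_b[of y z] \<open>y \<in> S\<close> by blast
        then have "(\<Sum>x\<in>S. c x * a x z) = 0" unfolding a_def by (rule rel)
        then show ?thesis by simp
      qed auto
    qed
    finally show ?thesis .
  qed
  \<comment> \<open>Weighting these equations by \<open>c\<close> itself produces a sum of squares,
    so the body combination vanishes at every point.\<close>
  then have "(\<Sum>y\<in>S. c y * (\<Sum>z\<in>Pow I. (\<Sum>x\<in>S. c x * g x z) * g y z)) = 0"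
    by simp
  also have "(\<Sum>y\<in>S. c y * (\<Sum>z\<in>Pow I. (\<Sum>x\<in>S. c x * g x z) * g y z)) =
      (\<Sum>z\<in>Pow I. (\<Sum>x\<in>S. c x * g x z)\<^sup>2)"
    unfolding power2_eq_square sum_distrib_left[of _ _ S]
    by (subst sum.swap[of _ S]) (simp add: sum_distrib_left mult_ac)
  finally have "\<forall>z\<in>Pow I. (\<Sum>x\<in>S. c x * g x z) = 0"
    using I by (simp add: sum_nonneg_eq_0_iff)
  then show False
    using body_vecs_independent[OF I S, of c M K] c by (auto simp: g_def)
qed

lemma bkr_Pow:
  assumes I: "finite I" and A: "A \<subseteq> Pow I" and B: "B \<subseteq> Pow I" and X: "X \<subseteq> Pow I"
    and wit: "\<And>x. x \<in> X \<Longrightarrow> \<exists>K. (\<forall>y\<in>Pow I. y \<inter> K = x \<inter> K \<longrightarrow> y \<in> A) \<and>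
      (\<forall>y\<in>Pow I. y - K = x - K \<longrightarrow> y \<in> B)"
  shows "2 ^ card I * card X \<le> card A * card B"
proof -
  from wit obtain K where
    KA: "\<And>x y. x \<in> X \<Longrightarrow> y \<in> Pow I \<Longrightarrow> y \<inter> K x = x \<inter> K x \<Longrightarrow> y \<in> A" and
    KB: "\<And>x y. x \<in> X \<Longrightarrow> y \<in> Pow I \<Longrightarrow> y - K x = x - K x \<Longrightarrow> y \<in> B"
    by metis
  have fin: "finite A" "finite B"
    using I A B finite_subset by (metis finite_Pow_iff)+
  have step: "card X \<le> card {z \<in> A. sym_diff z M \<in> B}" if M: "M \<in> Pow I" for M
  proof (rule order_trans[OF reimer_flock[OF I X, of K M]], intro card_mono subsetI)
    fix z assume "z \<in> {z \<in> Pow I. (\<exists>x\<in>X. z \<inter> K x = x \<inter> K x) \<and>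
      (\<exists>x\<in>X. \<forall>i\<in>I - K x. i \<in> z \<longleftrightarrow> (i \<in> x) \<noteq> (i \<in> M))}"
    then obtain x where z: "z \<in> Pow I" "z \<in> A" and x: "x \<in> X"
      "\<And>i. i \<in> I - K x \<Longrightarrow> i \<in> z \<longleftrightarrow> (i \<in> x) \<noteq> (i \<in> M)"
      using KA by blast
    have "sym_diff z M \<in> Pow I" using z M by auto
    \<comment> \<open>Reflecting along \<open>M\<close> a second time brings \<open>z\<close> back
      onto the yellow wing of \<open>x\<close>.\<close>
    moreover have "sym_diff z M - K x = x - K x"
      using x z M X by blast
    ultimately show "z \<in> {z \<in> A. sym_diff z M \<in> B}"
      using z KB[OF x(1)] by blast
  qed (use fin in simp)
  \<comment> \<open>the pairs in \<open>A \<times> B\<close> are classified by their symmetric difference\<close>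
  have "2 ^ card I * card X = (\<Sum>M\<in>Pow I. card X)"
    using I by (simp add: card_Pow)
  also have "\<dots> \<le> (\<Sum>M\<in>Pow I. card {z \<in> A. sym_diff z M \<in> B})"
    by (intro sum_mono step)
  also have "\<dots> = card (SIGMA M:Pow I. {z \<in> A. sym_diff z M \<in> B})"
    using I fin by simp
  also have "\<dots> \<le> card (A \<times> B)"
  proof (rule card_inj_on_le)
    show "inj_on (\<lambda>(M, z). (z, sym_diff z M)) (SIGMA M:Pow I. {z \<in> A. sym_diff z M \<in> B})"
      by (auto simp: inj_on_def)
  qed (use fin in auto)
  finally show ?thesis by (simp add: card_cartesian_product)
qed

section \<open>Dyadic discretisation\<close>

definition grid :: "nat \<Rightarrow> ('n \<Rightarrow> nat) set" where
  "grid n = {k. \<forall>i. k i < 2 ^ n}"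

lemma finite_grid [simp]: "finite (grid n :: ('n::finite \<Rightarrow> nat) set)"
proof -
  have "grid n = (UNIV :: 'n set) \<rightarrow>\<^sub>E {..<2 ^ n}"
    by (auto simp: grid_def PiE_def)
  then show ?thesis by (simp add: finite_PiE)
qed

text \<open>Each coordinate is read as a set of \<open>n\<close> bits. Any bijection
  \<open>h\<close> serves, because a witness \<open>K\<close> becomes
  \<open>K \<times> UNIV\<close>, which contains either all bits of a coordinate or none; the order
  of the values is irrelevant.\<close>

lemma bkr_grid:
  fixes A B X :: "('n::finite \<Rightarrow> nat) set"
  assumes A: "A \<subseteq> grid n" and B: "B \<subseteq> grid n" and X: "X \<subseteq> grid n"
    and wit: "\<And>x. x \<in> X \<Longrightarrow> \<exists>K. (\<forall>y\<in>grid n. (\<forall>i\<in>K. y i = x i) \<longrightarrow> y \<in> A) \<and>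
      (\<forall>y\<in>grid n. (\<forall>i\<in>-K. y i = x i) \<longrightarrow> y \<in> B)"
  shows "(2 ^ n) ^ CARD('n) * card X \<le> card A * card B"
proof -
  have "card {..<2 ^ n :: nat} = card (Pow {..<n})"
    by (simp add: card_Pow)
  then obtain h where h: "bij_betw h {..<2 ^ n :: nat} (Pow {..<n})"
    by (metis finite_same_card_bij finite_lessThan finite_Pow_iff)
  define e where "e = (\<lambda>k :: 'n \<Rightarrow> nat. SIGMA i:UNIV. h (k i))"
  define I where "I = (UNIV :: 'n set) \<times> {..<n}"
  have e_Pow: "e ` grid n \<subseteq> Pow I"
    using bij_betwE[OF h] by (fastforce simp: e_def I_def grid_def)
  have hk: "h (k i) = {j. (i, j) \<in> e k}" for k i
    by (simp add: e_def)
  have inj: "inj_on e (grid n)"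
  proof (rule inj_onI, rule ext)
    fix k l i assume kl: "k \<in> grid n" "l \<in> grid n" "e k = e l"
    then have "h (k i) = h (l i)" by (simp add: hk)
    then show "k i = l i"
      using bij_betw_imp_inj_on[OF h] kl by (simp add: inj_on_eq_iff grid_def)
  qed
  have surj: "\<exists>k\<in>grid n. y = e k" if "y \<in> Pow I" for y
  proof -
    have "\<exists>m<2 ^ n. h m = {j. (i, j) \<in> y}" for i
    proof -
      have "{j. (i, j) \<in> y} \<in> Pow {..<n}" using that by (auto simp: I_def)
      then have "{j. (i, j) \<in> y} \<in> h ` {..<2 ^ n}"
        using bij_betw_imp_surj_on[OF h] by simp
      then show ?thesis by auto
    qed
    then obtain k where "\<And>i. k i < 2 ^ n \<and> h (k i) = {j. (i, j) \<in> y}" by metis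
    then have "k \<in> grid n" "y = e k" by (auto simp: grid_def e_def)
    then show ?thesis by blast
  qed
  have eq_iff: "k i = l i \<longleftrightarrow> {j. (i, j) \<in> e k} = {j. (i, j) \<in> e l}"
    if "k \<in> grid n" "l \<in> grid n" for k l i
    using that bij_betw_imp_inj_on[OF h] by (simp add: hk[symmetric] inj_on_eq_iff grid_def)
  have "2 ^ card I * card (e ` X) \<le> card (e ` A) * card (e ` B)"
  proof (rule bkr_Pow)
    show "finite I" by (simp add: I_def)
    fix x assume "x \<in> e ` X"
    then obtain k where k: "k \<in> X" "x = e k" by auto
    then obtain K where K: "\<forall>y\<in>grid n. (\<forall>i\<in>K. y i = k i) \<longrightarrow> y \<in> A"
        "\<forall>y\<in>grid n. (\<forall>i\<in>-K. y i = k i) \<longrightarrow> y \<in> B"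
      using wit by blast
    have "y \<in> e ` A" if y: "y \<in> Pow I" "y \<inter> K \<times> UNIV = x \<inter> K \<times> UNIV" for y
    proof -
      obtain l where l: "l \<in> grid n" "y = e l" using surj[OF y(1)] by blast
      have "l i = k i" if "i \<in> K" for i
      proof -
        have "(i, j) \<in> y \<longleftrightarrow> (i, j) \<in> x" for j
          using \<open>y \<inter> K \<times> UNIV = x \<inter> K \<times> UNIV\<close> \<open>i \<in> K\<close> by blast
        then show ?thesis using eq_iff[of l k i] l k X by auto
      qed
      then show ?thesis using K l by blast
    qed
    moreover have "y \<in> e ` B" if y: "y \<in> Pow I" "y - K \<times> UNIV = x - K \<times> UNIV" for y
    proof -
      obtain l where l: "l \<in> grid n" "y = e l" using surj[OF y(1)] by blast
      have "l i = k i" if "i \<in> -K" for i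
      proof -
        have "(i, j) \<in> y \<longleftrightarrow> (i, j) \<in> x" for j
          using \<open>y - K \<times> UNIV = x - K \<times> UNIV\<close> \<open>i \<in> -K\<close> by blast
        then show ?thesis using eq_iff[of l k i] l k X by auto
      qed
      then show ?thesis using K l by blast
    qed
    ultimately show "\<exists>K. (\<forall>y\<in>Pow I. y \<inter> K = x \<inter> K \<longrightarrow> y \<in> e ` A) \<and>
        (\<forall>y\<in>Pow I. y - K = x - K \<longrightarrow> y \<in> e ` B)"
      by (intro exI[of _ "K \<times> UNIV"]) blast
  qed (use A B X e_Pow in blast)+
  moreover have "card I = n * CARD('n)"
    by (simp add: I_def card_cartesian_product)
  ultimately show ?thesis
    using A B X by (simp add: card_image inj_on_subset[OF inj] power_mult)
qed

text \<open>The cells are half-open; within the cube, \<open>min\<close> only affects the faces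
  \<open>x $ i = 1\<close>, which are put into the last cell instead of forming one of index
  \<open>2 ^ n\<close>.\<close>

definition cell_index :: "nat \<Rightarrow> real ^ 'n \<Rightarrow> 'n \<Rightarrow> nat" where
  "cell_index n x = (\<lambda>i. min (nat \<lfloor>2 ^ n * x $ i\<rfloor>) (2 ^ n - 1))"

lemma cell_index_grid: "cell_index n x \<in> grid n"
  by (simp add: cell_index_def grid_def less_eq_Suc_le[symmetric] min_less_iff_disj)

lemma cell_index_eq_iff:
  assumes "0 \<le> t" "t \<le> 1" "m < 2 ^ n"
  shows "min (nat \<lfloor>2 ^ n * t\<rfloor>) (2 ^ n - 1) = m \<longleftrightarrow>
    real m \<le> 2 ^ n * t \<and> (2 ^ n * t < real m + 1 \<or> m = 2 ^ n - 1)"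
proof -
  have "0 \<le> 2 ^ n * t" using assms by simp
  then have fl: "real k \<le> 2 ^ n * t \<longleftrightarrow> k \<le> nat \<lfloor>2 ^ n * t\<rfloor>" for k
    by (simp add: le_nat_iff le_floor_iff)
  have "2 ^ n * t < real m + 1 \<longleftrightarrow> \<not> Suc m \<le> nat \<lfloor>2 ^ n * t\<rfloor>"
    unfolding fl[of "Suc m", symmetric] by (simp add: add.commute not_le)
  then show ?thesis
    using fl[of m] assms(3) by (auto simp: min_def)
qed

lemma mem_unit_cube: "x \<in> unit_cube \<longleftrightarrow> (\<forall>i. 0 \<le> x $ i \<and> x $ i \<le> 1)"
  by (simp add: unit_cube_def)

lemma unit_cube_eq_cbox: "unit_cube = cbox 0 (1 :: real ^ 'n)"
  by (auto simp: mem_unit_cube mem_box_cart)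

lemma unit_cube_borel [measurable]: "unit_cube \<in> sets borel"
  by (simp add: unit_cube_eq_cbox)

lemma unit_cube_cell:
  fixes x :: "real ^ 'n"
  assumes "k \<in> grid n"
  shows "x \<in> unit_cube \<and> cell_index n x = k \<longleftrightarrow> (\<forall>i. real (k i) / 2 ^ n \<le> x $ i \<and>
    (x $ i < (real (k i) + 1) / 2 ^ n \<or> k i = 2 ^ n - 1 \<and> x $ i \<le> 1))" (is "?l \<longleftrightarrow> ?r")
proof
  have *: "(x $ i < (real (k i) + 1) / 2 ^ n) = (2 ^ n * x $ i < real (k i) + 1)"
      "(real (k i) / 2 ^ n \<le> x $ i) = (real (k i) \<le> 2 ^ n * x $ i)" for i
    by (simp_all add: field_simps)
  have kn: "k i < 2 ^ n" for i using assms by (simp add: grid_def)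
  show ?r if ?l
    using that kn cell_index_eq_iff[of "x $ _" "k _" n]
    unfolding * by (auto simp: cell_index_def mem_unit_cube)
  show ?l if r: ?r
  proof -
    have "0 \<le> x $ i \<and> x $ i \<le> 1" for i
    proof -
      have "0 \<le> real (k i) / 2 ^ n" by simp
      moreover have "(real (k i) + 1) / 2 ^ n \<le> 1"
      proof -
        have "real (Suc (k i)) \<le> real (2 ^ n)" using kn[of i] by (simp only: of_nat_le_iff Suc_le_eq)
        then show ?thesis by simp
      qed
      ultimately show ?thesis using r by (smt (verit))
    qed
    then show ?l
      using r kn cell_index_eq_iff[of "x $ _" "k _" n]
      unfolding * by (auto simp: cell_index_def mem_unit_cube)
  qed
qed

lemma cell_measure:
  fixes k :: "'n::finite \<Rightarrow> nat"
  assumes k: "k \<in> grid n"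
  defines "Q \<equiv> {x \<in> unit_cube. cell_index n x = k} :: (real ^ 'n) set"
  shows "Q \<in> sets borel" and "measure lborel Q = 1 / (2 ^ n) ^ CARD('n)"
proof -
  define a :: "real ^ 'n" where "a = (\<chi> i. real (k i) / 2 ^ n)"
  define b :: "real ^ 'n" where "b = (\<chi> i. (real (k i) + 1) / 2 ^ n)"
  have Q: "Q = {x. \<forall>i. real (k i) / 2 ^ n \<le> x $ i \<and>
      (x $ i < (real (k i) + 1) / 2 ^ n \<or> k i = 2 ^ n - 1 \<and> x $ i \<le> 1)}"
    unfolding Q_def unit_cube_cell[OF k] ..
  have [measurable]: "(\<lambda>x :: real ^ 'n. x $ i) \<in> borel_measurable borel" for i
    by (intro borel_measurable_continuous_onI continuous_intros)
  show meas: "Q \<in> sets borel" unfolding Q by measurable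
  \<comment> \<open>Squeezing the cell between the open and the closed box with the same corners
    makes it irrelevant which of its faces belong to it.\<close>
  have sub1: "box a b \<subseteq> Q"
    by (auto simp: Q mem_box_cart a_def b_def less_imp_le)
  have "1 \<le> (real (k i) + 1) / 2 ^ n" if "k i = 2 ^ n - 1" for i
    using that by (simp add: of_nat_diff)
  then have "x $ i \<le> (real (k i) + 1) / 2 ^ n" if "x \<in> Q" for x i
    using that unfolding Q by (smt (verit) mem_Collect_eq)
  then have sub2: "Q \<subseteq> cbox a b"
    by (auto simp: Q mem_box_cart a_def b_def)
  have ab: "a $ i \<le> b $ i" "b $ i - a $ i = 1 / 2 ^ n" for i
    by (simp_all add: a_def b_def divide_right_mono diff_divide_distrib[symmetric])
  have cb: "measure lborel (cbox a b) = 1 / (2 ^ n) ^ CARD('n)"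
  proof -
    have "cbox a b \<noteq> {}" using ab by (simp add: interval_ne_empty_cart)
    then have "measure lborel (cbox a b) = (\<Prod>i\<in>UNIV. b $ i - a $ i)"
      by (rule content_cbox_cart)
    then show ?thesis by (simp add: ab power_one_over)
  qed
  have "measure lborel (box a b) = measure lborel (cbox a b)"
    by (simp add: measure_def emeasure_lborel_box_eq emeasure_lborel_cbox_eq)
  moreover have "measure lborel (box a b) \<le> measure lborel Q"
    using sub1 sub2 meas by (intro measure_mono_fmeasurable)
      (auto intro: fmeasurableI2[OF fmeasurable_cbox])
  moreover have "measure lborel Q \<le> measure lborel (cbox a b)"
    using sub2 meas by (intro measure_mono_fmeasurable) auto
  ultimately show "measure lborel Q = 1 / (2 ^ n) ^ CARD('n)"
    using cb by simp
qed

lemma cells_measure: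
  fixes E :: "('n::finite \<Rightarrow> nat) set"
  assumes E: "E \<subseteq> grid n"
  defines "Q \<equiv> {x \<in> unit_cube. cell_index n x \<in> E} :: (real ^ 'n) set"
  shows "Q \<in> sets borel" and "measure lborel Q = card E / (2 ^ n) ^ CARD('n)"
proof -
  define P :: "('n \<Rightarrow> nat) \<Rightarrow> (real ^ 'n) set" where
    "P = (\<lambda>k. {x \<in> unit_cube. cell_index n x = k})"
  have fin: "finite E" using E finite_subset[OF _ finite_grid] by blast
  have Q: "Q = (\<Union>k\<in>E. P k)" by (auto simp: Q_def P_def)
  have P: "P k \<in> sets borel" "measure lborel (P k) = 1 / (2 ^ n) ^ CARD('n)" if "k \<in> E" for k
    using cell_measure[of k n] that E unfolding P_def by auto
  show "Q \<in> sets borel" unfolding Q using P fin by auto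
  have "P k \<in> fmeasurable lborel" if "k \<in> E" for k
    by (rule fmeasurableI2[OF fmeasurable_cbox[of 0 1]])
      (use P that in \<open>auto simp: P_def unit_cube_eq_cbox\<close>)
  then have "measure lborel Q = (\<Sum>k\<in>E. measure lborel (P k))"
    unfolding Q using fin
    by (intro measure_finite_Union) (auto simp: P_def disjoint_family_on_def fmeasurable_def less_top)
  then show "measure lborel Q = card E / (2 ^ n) ^ CARD('n)"
    by (simp add: P)
qed

section \<open>Outer approximation by dyadic cells\<close>

definition blowup :: "nat \<Rightarrow> (real ^ 'n) set \<Rightarrow> (real ^ 'n) set" where
  "blowup n X = {x \<in> unit_cube. cell_index n x \<in> cell_index n ` X}"

lemma cell_index_dist:
  fixes x y :: "real ^ 'n"
  assumes "x \<in> unit_cube" "y \<in> unit_cube" "cell_index n x = cell_index n y"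
  shows "dist x y \<le> CARD('n) * (1 / 2 ^ n)"
proof -
  have "\<bar>(x - y) $ i\<bar> \<le> 1 / 2 ^ n" for i
  proof -
    define k where "k = cell_index n y i"
    have bounds: "k / 2 ^ n \<le> z $ i \<and> z $ i \<le> (real k + 1) / 2 ^ n"
      if "z \<in> unit_cube" "cell_index n z = cell_index n y" for z :: "real ^ 'n"
    proof -
      have "(real (2 ^ n - 1) + 1) / 2 ^ n = (1::real)" by (simp add: of_nat_diff)
      then show ?thesis
        using that unit_cube_cell[OF cell_index_grid, of z n y]
        unfolding k_def by (smt (verit))
    qed
    have "(real k + 1) / 2 ^ n = k / 2 ^ n + 1 / 2 ^ n" by (simp add: add_divide_distrib)
    then show ?thesis
      using bounds[of x] bounds[of y] assms by (simp add: abs_le_iff)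
  qed
  then have "(\<Sum>i\<in>UNIV. \<bar>(x - y) $ i\<bar>) \<le> (\<Sum>i\<in>(UNIV::'n set). 1 / 2 ^ n)"
    by (rule sum_mono)
  then show ?thesis
    using norm_le_l1_cart[of "x - y"] by (simp add: dist_norm)
qed

lemma blowup_measure:
  fixes X :: "(real ^ 'n) set"
  shows "blowup n X \<in> sets borel"
    and "measure lborel (blowup n X) = card (cell_index n ` X) / (2 ^ n) ^ CARD('n)"
proof -
  have "cell_index n ` X \<subseteq> grid n" using cell_index_grid by auto
  note cells_measure[OF this, folded blowup_def]
  then show "blowup n X \<in> sets borel"
    "measure lborel (blowup n X) = card (cell_index n ` X) / (2 ^ n) ^ CARD('n)" .
qed

text \<open>A point off the closed set has positive distance to it while cell diameters tend to 0,
  so the indicators converge pointwise. Closedness is essential: a countable dense subset of the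
  cube meets every cell.\<close>

lemma measure_blowup_tendsto:
  fixes X :: "(real ^ 'n) set"
  assumes "closed X" and X: "X \<subseteq> unit_cube"
  shows "(\<lambda>n. measure lborel (blowup n X)) \<longlonglongrightarrow> measure lborel X"
proof -
  have [measurable]: "blowup n X \<in> sets borel" "X \<in> sets borel" for n
    using blowup_measure assms by auto
  have "(\<lambda>n. \<integral>x. indicat_real (blowup n X) x \<partial>lborel) \<longlonglongrightarrow> (\<integral>x. indicat_real X x \<partial>lborel)"
  proof (rule integral_dominated_convergence)
    show "integrable lborel (indicat_real (unit_cube :: (real ^ 'n) set))"
      unfolding unit_cube_eq_cbox
      by (intro integrable_real_indicator) (auto simp: emeasure_lborel_cbox_eq)
    show "AE x in lborel. norm (indicat_real (blowup n X) x) \<le> indicat_real unit_cube x" for n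
      by (auto simp: blowup_def indicator_def)
    show "AE x in lborel. (\<lambda>n. indicat_real (blowup n X) x) \<longlonglongrightarrow> indicat_real X x"
    proof (rule AE_I2)
      fix x :: "real ^ 'n"
      show "(\<lambda>n. indicat_real (blowup n X) x) \<longlonglongrightarrow> indicat_real X x"
      proof (cases "x \<in> X")
        case True
        then have "x \<in> blowup n X" for n using X by (auto simp: blowup_def)
        then show ?thesis using True by simp
      next
        case False
        then obtain e where e: "e > 0" "ball x e \<inter> X = {}"
          using \<open>closed X\<close> unfolding closed_def open_contains_ball by blast
        have "(\<lambda>n. CARD('n) * (1 / 2 ^ n :: real)) \<longlonglongrightarrow> real CARD('n) * 0"
          by (intro tendsto_mult tendsto_const LIMSEQ_divide_realpow_zero) simp
        then have "\<forall>\<^sub>F n in sequentially. CARD('n) * (1 / 2 ^ n :: real) < e"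
          by (rule order_tendstoD(2)) (simp add: e)
        then have "\<forall>\<^sub>F n in sequentially. indicat_real (blowup n X) x = indicat_real X x"
        proof eventually_elim
          case (elim n)
          have "x \<notin> blowup n X"
          proof
            assume "x \<in> blowup n X"
            then obtain y where "y \<in> X" "x \<in> unit_cube" "cell_index n x = cell_index n y"
              by (auto simp: blowup_def)
            then have "y \<in> ball x e" using cell_index_dist[of x y n] X elim by auto
            then show False using e \<open>y \<in> X\<close> by auto
          qed
          then show ?case using False by simp
        qed
        then show ?thesis by (rule tendsto_eventually)
      qed
    qed
  qed simp_all
  then show ?thesis by simp
qed

text \<open>The indices of the cells met by each set satisfy the grid inequality. Dividing by the
  squared number of cells gives the inequality for blowups, which passes to the limit as the unions
  are finite and hence closed.\<close>

lemma bkr_closed_cylinders: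
  fixes C D :: "'n set \<Rightarrow> (real ^ 'n) set"
  assumes C: "\<And>K. closed (C K)" "\<And>K. C K \<subseteq> unit_cube" "\<And>K x. x \<in> C K \<Longrightarrow> cyl K x \<subseteq> C K"
    and D: "\<And>K. closed (D K)" "\<And>K. D K \<subseteq> unit_cube" "\<And>K x. x \<in> D K \<Longrightarrow> cyl (- K) x \<subseteq> D K"
  shows "measure lborel (\<Union>K. C K \<inter> D K) \<le> measure lborel (\<Union>K. C K) * measure lborel (\<Union>K. D K)"
proof (rule LIMSEQ_le)
  have fill: "\<exists>v. v \<in> cyl K w \<and> cell_index n v = y"
    if "w \<in> unit_cube" "y \<in> grid n" "\<forall>i\<in>K. y i = cell_index n w i"
    for K n y and w :: "real ^ 'n"
  proof -
    \<comment> \<open>Keep \<open>w\<close> on \<open>K\<close> and take the lower corner of the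
      cell elsewhere: a cylinder through \<open>w\<close> meets every cell with the same indices on
      \<open>K\<close>, so discretisation preserves cylinders.\<close>
    define v where "v = (\<chi> i. if i \<in> K then w $ i else y i / 2 ^ n)"
    have y: "y i < 2 ^ n" for i using that by (simp add: grid_def)
    then have "real (y i) \<le> 2 ^ n" for i
      by (metis less_imp_le of_nat_le_iff of_nat_numeral of_nat_power)
    then have "v \<in> unit_cube" using that by (auto simp: v_def mem_unit_cube)
    moreover have "cell_index n v i = y i" for i
      using that(3) y[of i] by (auto simp: cell_index_def v_def)
    ultimately show ?thesis
      by (intro exI[of _ v]) (auto simp: cyl_def v_def)
  qed
  have "measure lborel (blowup n (\<Union>K. C K \<inter> D K)) \<le>
      measure lborel (blowup n (\<Union>K. C K)) * measure lborel (blowup n (\<Union>K. D K))" for n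
  proof -
    have "(2 ^ n) ^ CARD('n) * card (cell_index n ` (\<Union>K. C K \<inter> D K)) \<le>
      card (cell_index n ` (\<Union>K. C K)) * card (cell_index n ` (\<Union>K. D K))"
    proof (rule bkr_grid)
      fix k assume "k \<in> cell_index n ` (\<Union>K. C K \<inter> D K)"
      then obtain K w where w: "w \<in> C K" "w \<in> D K" "k = cell_index n w" by auto
      have "w \<in> unit_cube" using w C by auto
      have "y \<in> cell_index n ` (\<Union>K. C K)" if y: "y \<in> grid n" "\<forall>i\<in>K. y i = k i" for y
      proof -
        obtain v where "v \<in> cyl K w" "cell_index n v = y"
          using fill[OF \<open>w \<in> unit_cube\<close> y(1)] y(2) w(3) by auto
        then show ?thesis using C(3)[OF w(1)] by auto
      qed
      moreover have "y \<in> cell_index n ` (\<Union>K. D K)"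
        if y: "y \<in> grid n" "\<forall>i\<in>-K. y i = k i" for y
      proof -
        obtain v where "v \<in> cyl (- K) w" "cell_index n v = y"
          using fill[OF \<open>w \<in> unit_cube\<close> y(1)] y(2) w(3) by auto
        then show ?thesis using D(3)[OF w(2)] by auto
      qed
      ultimately show "\<exists>K. (\<forall>y\<in>grid n. (\<forall>i\<in>K. y i = k i) \<longrightarrow> y \<in> cell_index n ` (\<Union>K. C K)) \<and>
          (\<forall>y\<in>grid n. (\<forall>i\<in>-K. y i = k i) \<longrightarrow> y \<in> cell_index n ` (\<Union>K. D K))"
        by (intro exI[of _ K]) simp
    qed (auto simp: cell_index_grid)
    then have "real ((2 ^ n) ^ CARD('n) * card (cell_index n ` (\<Union>K. C K \<inter> D K))) \<le>
      real (card (cell_index n ` (\<Union>K. C K)) * card (cell_index n ` (\<Union>K. D K)))"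
      by (simp only: of_nat_le_iff)
    then show ?thesis
      unfolding blowup_measure by (simp add: divide_simps mult_ac)
  qed
  then show "\<exists>N. \<forall>n\<ge>N. measure lborel (blowup n (\<Union>K. C K \<inter> D K)) \<le>
      measure lborel (blowup n (\<Union>K. C K)) * measure lborel (blowup n (\<Union>K. D K))"
    by blast
  show "(\<lambda>n. measure lborel (blowup n (\<Union>K. C K \<inter> D K))) \<longlonglongrightarrow> measure lborel (\<Union>K. C K \<inter> D K)"
    using C(1) D(1) by (intro measure_blowup_tendsto closed_UN) (auto dest: subsetD[OF C(2)])
  show "(\<lambda>n. measure lborel (blowup n (\<Union>K. C K)) * measure lborel (blowup n (\<Union>K. D K)))
      \<longlonglongrightarrow> measure lborel (\<Union>K. C K) * measure lborel (\<Union>K. D K)"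
    using C(1) D(1) by (intro tendsto_mult measure_blowup_tendsto closed_UN)
      (auto dest: subsetD[OF C(2)] subsetD[OF D(2)])
qed

section \<open>Measurability of projections\<close>

text \<open>These are the analytic sets, with Baire space carrying the product topology. The
  sequence serves as a code for membership, and codes can be merged countably often.\<close>

definition souslin :: "'a::topological_space set \<Rightarrow> bool" where
  "souslin A \<longleftrightarrow> (\<exists>F :: ('a \<times> (nat \<Rightarrow> nat)) set. closed F \<and> A = fst ` F)"

lemma souslin_closed:
  assumes "closed A"
  shows "souslin A"
  unfolding souslin_def using assms
  by (intro exI[of _ "A \<times> UNIV"]) (simp add: closed_Times)

lemma continuous_on_reindex:
  fixes p :: "nat \<Rightarrow> nat"
  shows "continuous_on UNIV (\<lambda>z :: 'a::topological_space \<times> (nat \<Rightarrow> nat). (fst z, \<lambda>i. snd z (p i)))"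
  by (rule continuous_on_Pair[OF continuous_on_fst[OF continuous_on_id]],
      rule continuous_on_coordinatewise_then_product,
      rule continuous_on_product_then_coordinatewise[OF continuous_on_snd[OF continuous_on_id]])

lemma souslin_UN:
  fixes A :: "nat \<Rightarrow> 'a::topological_space set"
  assumes "\<And>n. souslin (A n)"
  shows "souslin (\<Union>n. A n)"
proof -
  obtain G :: "nat \<Rightarrow> ('a \<times> (nat \<Rightarrow> nat)) set"
    where G: "\<And>n. closed (G n)" "\<And>n. A n = fst ` G n"
    using assms unfolding souslin_def by metis
  \<comment> \<open>Entry 0 names a member of the union and the tail is a code for that member. The
    condition is closed because fixing an entry is clopen.\<close>
  define F where "F = {z. (fst z, \<lambda>i. snd z (Suc i)) \<in> G (snd z 0)}"
  have "F = (\<Inter>n. (\<lambda>z. snd z 0) -` (- {n}) \<union> (\<lambda>z. (fst z, \<lambda>i. snd z (Suc i))) -` G n)"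
    by (auto simp: F_def)
  moreover have "closed \<dots>"
  proof (intro closed_INT ballI closed_Un closed_vimage G continuous_on_reindex)
    show "closed (- {n :: nat})" for n by (simp add: closed_def open_discrete)
    show "continuous_on UNIV (\<lambda>z :: 'a \<times> (nat \<Rightarrow> nat). snd z 0)"
      by (rule continuous_on_product_then_coordinatewise[OF continuous_on_snd[OF continuous_on_id]])
  qed
  moreover have "(\<Union>n. A n) = fst ` F"
  proof (intro equalityI subsetI)
    fix x assume "x \<in> (\<Union>n. A n)"
    then obtain n s where "(x, s) \<in> G n" using G by auto
    then have "(x, case_nat n s) \<in> F" by (simp add: F_def)
    then show "x \<in> fst ` F" by force
  next
    fix x assume "x \<in> fst ` F"
    then show "x \<in> (\<Union>n. A n)" using G by (force simp: F_def)
  qed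
  ultimately show ?thesis unfolding souslin_def by metis
qed

lemma souslin_INT:
  fixes A :: "nat \<Rightarrow> 'a::topological_space set"
  assumes "\<And>n. souslin (A n)"
  shows "souslin (\<Inter>n. A n)"
proof -
  obtain G :: "nat \<Rightarrow> ('a \<times> (nat \<Rightarrow> nat)) set"
    where G: "\<And>n. closed (G n)" "\<And>n. A n = fst ` G n"
    using assms unfolding souslin_def by metis
  \<comment> \<open>A single sequence stores all the codes: the entries at
    \<open>prod_encode (n, i)\<close> form the code for the set with index \<open>n\<close>.\<close>
  define F where "F = (\<Inter>n. (\<lambda>z. (fst z, \<lambda>i. snd z (prod_encode (n, i)))) -` G n)"
  have "closed F"
    unfolding F_def by (intro closed_INT ballI closed_vimage G continuous_on_reindex)
  moreover have "(\<Inter>n. A n) = fst ` F"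
  proof (intro equalityI subsetI)
    fix x assume "x \<in> (\<Inter>n. A n)"
    then have "\<forall>n. \<exists>s. (x, s) \<in> G n" using G by force
    then obtain s where "\<And>n. (x, s n) \<in> G n" by metis
    then have "(x, \<lambda>j. case prod_decode j of (n, i) \<Rightarrow> s n i) \<in> F"
      by (simp add: F_def)
    then show "x \<in> fst ` F" by force
  next
    fix x assume "x \<in> fst ` F"
    then show "x \<in> (\<Inter>n. A n)" using G by (force simp: F_def)
  qed
  ultimately show ?thesis unfolding souslin_def by metis
qed

lemma souslin_open:
  fixes U :: "'a::metric_space set"
  assumes "open U"
  shows "souslin U"
proof (cases "U = UNIV")
  case True
  then show ?thesis by (simp add: souslin_closed)
next
  case False
  \<comment> \<open>Open sets are countable unions of closed ones. The case of the whole space is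
    separate because \<open>infdist\<close> to the empty set is 0 by convention.\<close>
  have "U = (\<Union>n. {x. inverse (of_nat (Suc n)) \<le> infdist x (- U)})"
  proof (intro equalityI subsetI)
    fix x assume "x \<in> U"
    then have "0 < infdist x (- U)"
      using False assms by (intro infdist_pos_not_in_closed) auto
    then obtain n where "inverse (of_nat (Suc n)) < infdist x (- U)"
      using reals_Archimedean by blast
    then show "x \<in> (\<Union>n. {x. inverse (of_nat (Suc n)) \<le> infdist x (- U)})"
      by (auto intro: less_imp_le)
  next
    fix x assume "x \<in> (\<Union>n. {x. inverse (of_nat (Suc n)) \<le> infdist x (- U)})"
    then obtain n :: nat where "inverse (of_nat (Suc n)) \<le> infdist x (- U)" by auto
    moreover have "0 < inverse (real (Suc n))" by simp
    ultimately have "0 < infdist x (- U)" by (rule less_le_trans[rotated])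
    then show "x \<in> U" by (metis ComplI infdist_zero less_irrefl)
  qed
  moreover have "souslin \<dots>"
    by (intro souslin_UN souslin_closed closed_Collect_le continuous_intros)
  ultimately show ?thesis by simp
qed

lemma souslin_borel:
  fixes A :: "'a::metric_space set"
  assumes "A \<in> sets borel"
  shows "souslin A"
proof -
  have "A \<in> sigma_sets UNIV (Collect closed)"
    using assms by (simp add: borel_eq_closed)
  \<comment> \<open>Analytic sets are not closed under complements, so the induction carries a set
    together with its complement.\<close>
  then have "souslin A \<and> souslin (- A)"
  proof (induction rule: sigma_sets.induct)
    case (Union a)
    then show ?case using souslin_UN[of a] souslin_INT[of "\<lambda>i. - a i"] by simp
  qed (auto simp: souslin_closed souslin_open open_Compl Compl_eq_Diff_UNIV[symmetric])
  then show ?thesis ..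
qed

section \<open>Capacitability of projections\<close>

lemma tendsto_fun_iff:
  fixes f :: "'c \<Rightarrow> 'a \<Rightarrow> 'b::topological_space"
  shows "(f \<longlongrightarrow> l) F \<longleftrightarrow> (\<forall>i. ((\<lambda>x. f x i) \<longlongrightarrow> l i) F)"
proof -
  have "limitin (product_topology (\<lambda>i. euclidean) UNIV) f l F \<longleftrightarrow>
      (\<forall>i. ((\<lambda>x. f x i) \<longlongrightarrow> l i) F)"
    by (simp add: limitin_componentwise)
  then show ?thesis by (simp add: euclidean_product_topology)
qed

lemma compact_prefix_set:
  fixes m :: "nat \<Rightarrow> nat"
  shows "compact {s. \<forall>i. s i \<le> m i}"
proof -
  have "compactin (product_topology (\<lambda>i. euclidean) UNIV) (\<Pi>\<^sub>E i\<in>UNIV. {..m i})"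
    unfolding compactin_PiE by (simp add: finite_imp_compact)
  moreover have "(\<Pi>\<^sub>E i\<in>UNIV. {..m i}) = {s. \<forall>i. s i \<le> m i}"
    by (auto simp: PiE_iff)
  ultimately show ?thesis by (simp add: euclidean_product_topology)
qed

text \<open>A point of the intersection is approximated by points of \<open>H\<close> whose codes
  obey the bound \<open>m\<close> in the first \<open>k\<close> entries only. Truncating all entries
  at \<open>m\<close> puts the codes into a compact set and changes any fixed entry for finitely
  many \<open>k\<close> only. A convergent subsequence of truncated codes is therefore one of the
  original codes, and closedness of \<open>H\<close> keeps the limit.\<close>

lemma closure_prefix_sections:
  fixes H :: "('a::metric_space \<times> 'b::metric_space \<times> (nat \<Rightarrow> nat)) set"
  assumes H: "closed H" "H \<subseteq> UNIV \<times> D \<times> UNIV" and D: "compact D"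
  shows "(\<Inter>k. closure (fst ` {z \<in> H. \<forall>i<k. snd (snd z) i \<le> m i})) \<subseteq> fst ` H"
proof
  fix x assume x: "x \<in> (\<Inter>k. closure (fst ` {z \<in> H. \<forall>i<k. snd (snd z) i \<le> m i}))"
  have "\<exists>z\<in>H. (\<forall>i<k. snd (snd z) i \<le> m i) \<and> dist (fst z) x < inverse (Suc k)" for k
  proof -
    have "x \<in> closure (fst ` {z \<in> H. \<forall>i<k. snd (snd z) i \<le> m i})" using x by blast
    moreover have "0 < inverse (real (Suc k))" by simp
    ultimately show ?thesis unfolding closure_approachable by blast
  qed
  then obtain z where z: "\<And>k. z k \<in> H" "\<And>k i. i < k \<Longrightarrow> snd (snd (z k)) i \<le> m i"
    "\<And>k. dist (fst (z k)) x < inverse (Suc k)" by metis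
  define t where "t = (\<lambda>k i. min (snd (snd (z k)) i) (m i))"
  have "compact (D \<times> {s. \<forall>i. s i \<le> m i})"
    using D compact_prefix_set by (rule compact_Times)
  moreover have "\<forall>k. (fst (snd (z k)), t k) \<in> D \<times> {s. \<forall>i. s i \<le> m i}"
  proof
    fix k
    have "z k \<in> UNIV \<times> D \<times> UNIV" using z(1)[of k] H(2) by (rule subsetD[rotated])
    then show "(fst (snd (z k)), t k) \<in> D \<times> {s. \<forall>i. s i \<le> m i}"
      by (simp add: t_def mem_Times_iff)
  qed
  ultimately obtain l r where "l \<in> D \<times> {s. \<forall>i. s i \<le> m i}" and r: "strict_mono r"
    and lim: "((\<lambda>k. (fst (snd (z k)), t k)) \<circ> r) \<longlonglongrightarrow> l"
    by (rule seq_compactE[OF compact_imp_seq_compact])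
  have "(\<lambda>k. fst (snd (z (r k)))) \<longlonglongrightarrow> fst l"
    using tendsto_fst[OF lim] by (simp add: o_def)
  moreover have "(\<lambda>k. snd (snd (z (r k)))) \<longlonglongrightarrow> snd l"
    unfolding tendsto_fun_iff
  proof
    fix i
    have "(\<lambda>k. t (r k)) \<longlonglongrightarrow> snd l" using tendsto_snd[OF lim] by (simp add: o_def)
    then have "(\<lambda>k. t (r k) i) \<longlonglongrightarrow> snd l i"
      by (simp add: tendsto_fun_iff)
    moreover have "\<forall>\<^sub>F k in sequentially. t (r k) i = snd (snd (z (r k))) i"
      using eventually_gt_at_top[of i]
    proof eventually_elim
      case (elim k)
      then have "i < r k" using seq_suble[OF r, of k] by simp
      then show ?case using z(2)[of i "r k"] by (simp add: t_def)
    qed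
    ultimately show "(\<lambda>k. snd (snd (z (r k))) i) \<longlonglongrightarrow> snd l i"
      by (rule Lim_transform_eventually)
  qed
  moreover have "(\<lambda>k. fst (z (r k))) \<longlonglongrightarrow> x"
  proof -
    have "(\<lambda>k. dist (fst (z k)) x) \<longlonglongrightarrow> 0"
      using z(3) by (intro tendsto_sandwich[OF _ _ tendsto_const LIMSEQ_inverse_real_of_nat])
        (auto intro: less_imp_le always_eventually)
    then have "(\<lambda>k. fst (z k)) \<longlonglongrightarrow> x" by (rule tendsto_dist_iff[THEN iffD2])
    then show ?thesis using r by (rule LIMSEQ_subseq_LIMSEQ[unfolded o_def])
  qed
  ultimately have "(\<lambda>k. (fst (z (r k)), fst (snd (z (r k))), snd (snd (z (r k)))))
      \<longlonglongrightarrow> (x, fst l, snd l)"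
    by (intro tendsto_Pair)
  then have "(x, fst l, snd l) \<in> H"
    using H(1) z(1) unfolding closed_sequential_limits by (metis (no_types, lifting) prod.collapse)
  then show "x \<in> fst ` H" by force
qed

text \<open>
  Choquet's capacity argument: the sequence entries are bounded one at a time while the outer
  measure of the projection stays above \<open>c\<close>; the resulting bound is a compact set of sequences.
\<close>

lemma closed_inner_projection:
  fixes H :: "('a::euclidean_space \<times> 'b::metric_space \<times> (nat \<Rightarrow> nat)) set"
  assumes H: "closed H" "H \<subseteq> C \<times> D \<times> UNIV" and C: "compact C" and D: "compact D"
    and c: "c < outer_measure_of lborel (fst ` H)"
  shows "\<exists>Z. closed Z \<and> Z \<subseteq> fst ` H \<and> c \<le> emeasure lborel Z"
proof -
  define E where "E = (\<lambda>k m. fst ` {z \<in> H. \<forall>i<k. snd (snd z) i \<le> m i})"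
  have step: "\<exists>m'. c < outer_measure_of lborel (E (Suc k) m') \<and> (\<forall>i<k. m' i = m i)"
    if Ekm: "c < outer_measure_of lborel (E k m)" for k and m :: "nat \<Rightarrow> nat"
  proof -
    have E: "E (Suc k) (m(k := j)) =
        fst ` {z \<in> H. (\<forall>i<k. snd (snd z) i \<le> m i) \<and> snd (snd z) k \<le> j}" for j
      unfolding E_def by (intro arg_cong[where f = "(`) fst"]) (auto simp: less_Suc_eq)
    have "incseq (\<lambda>j. E (Suc k) (m(k := j)))"
      unfolding E by (intro incseq_SucI image_mono) auto
    moreover have "E k m = (\<Union>j. E (Suc k) (m(k := j)))"
      unfolding E unfolding E_def by (auto intro!: image_eqI)
    \<comment> \<open>Outer measure is continuous along increasing sequences even of nonmeasurable
      sets, so some finite bound \<open>j\<close> on the entry \<open>k\<close> keeps the value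
      above \<open>c\<close>.\<close>
    ultimately have *: "outer_measure_of lborel (E k m) =
        (SUP j. outer_measure_of lborel (E (Suc k) (m(k := j))))"
      by (simp add: SUP_outer_measure_of_incseq)
    obtain j where "c < outer_measure_of lborel (E (Suc k) (m(k := j)))"
      using Ekm unfolding * less_SUP_iff by auto
    then show ?thesis by (intro exI[of _ "m(k := j)"]) auto
  qed
  have "\<exists>f. \<forall>k. c < outer_measure_of lborel (E k (f k)) \<and> (\<forall>i<k. f (Suc k) i = f k i)"
  proof (rule dependent_nat_choice)
    show "\<exists>m. c < outer_measure_of lborel (E 0 m)" using c by (simp add: E_def)
  qed (use step in blast)
  then obtain f where f: "\<And>k. c < outer_measure_of lborel (E k (f k))"
    and f_Suc: "\<And>k i. i < k \<Longrightarrow> f (Suc k) i = f k i" by blast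
  \<comment> \<open>The entry \<open>i\<close> is fixed from stage \<open>Suc i\<close> on, so the
    diagonal agrees with every \<open>f k\<close> on the entries that \<open>E k\<close>
    inspects.\<close>
  define m where "m = (\<lambda>i. f (Suc i) i)"
  have "f k i = m i" if "i < k" for i k
    using that by (induction k) (auto simp: f_Suc m_def less_Suc_eq)
  then have Em: "E k (f k) = E k m" for k by (simp add: E_def)
  have EC: "closure (E k m) \<subseteq> C" for k
    using H(2) compact_imp_closed[OF C] by (intro closure_minimal) (auto simp: E_def)
  \<comment> \<open>Compactness of \<open>C\<close> makes these measures finite, as continuity from
    above requires.\<close>
  have fin: "emeasure lborel (closure (E k m)) \<noteq> \<infinity>" for k
    using emeasure_bounded_finite[OF bounded_subset[OF compact_imp_bounded[OF C] EC], of k]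
    by (simp add: less_top)
  have "(INF k. emeasure lborel (closure (E k m))) = emeasure lborel (\<Inter>k. closure (E k m))"
    using fin by (intro INF_emeasure_decseq decseq_SucI closure_mono) (auto simp: E_def)
  moreover have "c \<le> emeasure lborel (closure (E k m))" for k
  proof -
    have "c < outer_measure_of lborel (E k m)" using f Em by metis
    also have "\<dots> \<le> outer_measure_of lborel (closure (E k m))"
      by (intro outer_measure_of_mono closure_subset)
    finally show ?thesis by simp
  qed
  ultimately have "c \<le> emeasure lborel (\<Inter>k. closure (E k m))"
    by (metis INF_greatest)
  moreover have "(\<Inter>k. closure (E k m)) \<subseteq> fst ` H"
    unfolding E_def using H D by (intro closure_prefix_sections) auto
  ultimately show ?thesis by (intro exI[of _ "\<Inter>k. closure (E k m)"]) auto
qed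

text \<open>The projection lies between a Borel hull \<open>G\<close> of the same outer measure and
  a countable union \<open>S\<close> of closed subsets. Their measures are finite and coincide by
  inner approximation, so the projection differs from \<open>S\<close> by part of a null
  set.\<close>

lemma projection_lebesgue:
  fixes H :: "('a::euclidean_space \<times> 'b::metric_space \<times> (nat \<Rightarrow> nat)) set"
  assumes H: "closed H" "H \<subseteq> C \<times> D \<times> UNIV" and C: "compact C" and D: "compact D"
  shows "fst ` H \<in> sets lebesgue"
proof -
  define P where "P = fst ` H"
  define \<Z> where "\<Z> = {Z. closed Z \<and> Z \<subseteq> P}"
  obtain G where G: "G \<in> sets lborel" "P \<subseteq> G" "outer_measure_of lborel P = emeasure lborel G"
    using outer_measure_of_attain[of P lborel] by auto
  have "emeasure lborel G \<le> emeasure lborel C"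
    using H(2) compact_imp_closed[OF C] outer_measure_of_mono[of P C lborel]
    by (force simp: P_def simp flip: G(3))
  then have finG: "emeasure lborel G < \<infinity>"
    using emeasure_bounded_finite[OF compact_imp_bounded[OF C]] by (rule le_less_trans)
  have "\<Z> \<noteq> {}" by (auto simp: \<Z>_def)
  then obtain f :: "nat \<Rightarrow> ennreal"
    where f: "range f \<subseteq> emeasure lborel ` \<Z>" "Sup (emeasure lborel ` \<Z>) = Sup (range f)"
    using ennreal_SUP_countable_SUP[of \<Z> "emeasure lborel"] by metis
  from f(1) have "\<forall>n. \<exists>Z\<in>\<Z>. f n = emeasure lborel Z" by blast
  then obtain Z where Z: "\<And>n. Z n \<in> \<Z>" "\<And>n. f n = emeasure lborel (Z n)" by metis
  define S where "S = (\<Union>n. Z n)"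
  have S: "S \<in> sets lborel" "S \<subseteq> P" using Z(1) by (auto simp: S_def \<Z>_def)
  have "emeasure lborel G \<le> emeasure lborel S"
  proof (rule dense_le)
    fix c assume "c < emeasure lborel G"
    then obtain W where "W \<in> \<Z>" "c \<le> emeasure lborel W"
      using closed_inner_projection[OF H C D, of c] G(3) by (auto simp: \<Z>_def P_def)
    then have "c \<le> Sup (emeasure lborel ` \<Z>)" by (auto intro: order_trans SUP_upper)
    also have "\<dots> = (SUP n. emeasure lborel (Z n))" by (simp add: f(2) Z(2))
    also have "\<dots> \<le> emeasure lborel S"
      using S(1) by (intro SUP_least emeasure_mono) (auto simp: S_def)
    finally show "c \<le> emeasure lborel S" .
  qed
  moreover have "emeasure lborel S \<le> emeasure lborel G"
    using S G by (intro emeasure_mono) auto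
  ultimately have "emeasure lborel (G - S) = 0"
    using S G finG by (subst emeasure_Diff) auto
  then have "G - S \<in> null_sets lborel" using S G by (auto intro: null_setsI)
  then show ?thesis
    using S G unfolding P_def[symmetric]
    by (intro sets_completionI[of P S "P - S" "G - S"]) auto
qed

section \<open>Borel sets in the cube\<close>

definition saturation :: "'n set \<Rightarrow> (real ^ 'n) set \<Rightarrow> (real ^ 'n) set" where
  "saturation K Z = {x \<in> unit_cube. \<exists>y\<in>Z. \<forall>i\<in>K. y $ i = x $ i}"

lemma closed_agree_on: "closed {z :: (real ^ 'n) \<times> (real ^ 'n). \<forall>i\<in>K. snd z $ i = fst z $ i}"
proof -
  have "{z :: (real ^ 'n) \<times> (real ^ 'n). \<forall>i\<in>K. snd z $ i = fst z $ i} =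
      (\<Inter>i\<in>K. {z. snd z $ i = fst z $ i})"
    by auto
  moreover have "closed \<dots>"
    by (intro closed_INT ballI closed_Collect_eq continuous_intros)
  ultimately show ?thesis by simp
qed

lemma compact_unit_cube: "compact (unit_cube :: (real ^ 'n) set)"
  by (simp add: unit_cube_eq_cbox)

text \<open>The saturation is a projection of a compact set of pairs; compactness is what makes the
  projection closed.\<close>

lemma saturation_closed:
  assumes "closed Z" "Z \<subseteq> unit_cube"
  shows "closed (saturation K Z)"
proof -
  have "compact Z"
    using assms compact_unit_cube by (metis compact_Int_closed inf.absorb2)
  then have "compact (unit_cube \<times> Z \<inter> {z. \<forall>i\<in>K. snd z $ i = fst z $ i})"
    by (intro compact_Int_closed compact_Times compact_unit_cube closed_agree_on)
  then have "compact (fst ` (unit_cube \<times> Z \<inter> {z. \<forall>i\<in>K. snd z $ i = fst z $ i}))"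
    by (intro compact_continuous_image continuous_intros)
  moreover have "fst ` (unit_cube \<times> Z \<inter> {z. \<forall>i\<in>K. snd z $ i = fst z $ i}) = saturation K Z"
    by (force simp: saturation_def)
  ultimately show ?thesis by (simp add: compact_imp_closed)
qed

lemma saturation_lebesgue:
  fixes T :: "(real ^ 'n) set"
  assumes "T \<in> sets borel" and T: "T \<subseteq> unit_cube"
  shows "saturation K T \<in> sets lebesgue"
proof -
  obtain F :: "((real ^ 'n) \<times> (nat \<Rightarrow> nat)) set" where F: "closed F" "T = fst ` F"
    using souslin_borel[OF assms(1)] unfolding souslin_def by blast
  \<comment> \<open>A triple holds a point, a witness in \<open>T\<close> agreeing with it on
    \<open>K\<close>, and a code for that witness. Replacing \<open>T\<close> by its codes makes the
    set closed, at the price of also projecting along Baire space.\<close>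
  define H :: "((real ^ 'n) \<times> (real ^ 'n) \<times> (nat \<Rightarrow> nat)) set" where
    "H = unit_cube \<times> unit_cube \<times> UNIV \<inter> snd -` F \<inter>
      (\<lambda>z. (fst z, fst (snd z))) -` {z. \<forall>i\<in>K. snd z $ i = fst z $ i}"
  have "closed H"
    unfolding H_def
    by (intro closed_Int closed_Times closed_vimage closed_agree_on F closed_UNIV
        compact_imp_closed[OF compact_unit_cube] continuous_intros)
  moreover have "H \<subseteq> unit_cube \<times> unit_cube \<times> UNIV" by (auto simp: H_def)
  ultimately have "fst ` H \<in> sets lebesgue"
    using compact_unit_cube compact_unit_cube by (rule projection_lebesgue)
  moreover have "fst ` H = saturation K T"
  proof (intro equalityI subsetI)
    fix x assume "x \<in> saturation K T"
    then obtain y s where "x \<in> unit_cube" "(y, s) \<in> F" "\<forall>i\<in>K. y $ i = x $ i" "y \<in> unit_cube"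
      using F(2) T by (auto simp: saturation_def)
    then have "(x, y, s) \<in> H" by (simp add: H_def)
    then show "x \<in> fst ` H" by force
  next
    fix x assume "x \<in> fst ` H"
    then obtain y s where "(x, y, s) \<in> H" by auto
    then show "x \<in> saturation K T"
      using F(2) by (force simp: H_def saturation_def)
  qed
  ultimately show ?thesis by simp
qed

lemma cyl_part_eq: "A \<subseteq> unit_cube \<Longrightarrow> cyl_part K A = unit_cube - saturation K (unit_cube - A)"
  unfolding cyl_part_def cyl_def saturation_def by blast

lemma cyl_part_subset: "cyl_part K A \<subseteq> A" "cyl_part K A \<subseteq> unit_cube"
  by (auto simp: cyl_part_def cyl_def)

lemma cyl_part_lebesgue:
  fixes A :: "(real ^ 'n) set"
  assumes "A \<in> sets borel" "A \<subseteq> unit_cube"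
  shows "cyl_part K A \<in> sets lebesgue"
proof -
  have "saturation K (unit_cube - A) \<in> sets lebesgue"
    using assms by (intro saturation_lebesgue) auto
  then show ?thesis
    unfolding cyl_part_eq[OF assms(2)] by (intro sets.Diff) auto
qed

lemma cyl_part_inner_closed:
  fixes A :: "(real ^ 'n) set"
  assumes A: "A \<in> sets borel" "A \<subseteq> unit_cube" and e: "0 < e"
  shows "\<exists>C. closed C \<and> C \<subseteq> cyl_part K A \<and> (\<forall>x\<in>C. cyl K x \<subseteq> C) \<and>
    measure lebesgue (cyl_part K A - C) \<le> e"
proof -
  obtain Z where Z: "closed Z" "Z \<subseteq> cyl_part K A" "cyl_part K A - Z \<in> lmeasurable"
    "emeasure lebesgue (cyl_part K A - Z) < ennreal e"
    using sets_lebesgue_inner_closed[OF cyl_part_lebesgue[OF A] e] .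
  define C where "C = saturation K Z"
  have ZU: "Z \<subseteq> unit_cube" using Z(2) cyl_part_subset by blast
  have "closed C" unfolding C_def using Z(1) ZU by (rule saturation_closed)
  \<comment> \<open>Points that agree on \<open>K\<close> have the same
    \<open>K\<close>-cylinder.\<close>
  moreover have "C \<subseteq> cyl_part K A"
    using Z(2) unfolding C_def saturation_def cyl_part_def cyl_def by fastforce
  moreover have "cyl K x \<subseteq> C" if x: "x \<in> C" for x
  proof -
    obtain y where "y \<in> Z" "\<forall>i\<in>K. y $ i = x $ i"
      using x by (auto simp: C_def saturation_def)
    then show ?thesis
      by (auto simp: C_def saturation_def cyl_def intro!: bexI[of _ y])
  qed
  moreover have "measure lebesgue (cyl_part K A - C) \<le> e"
  proof -
    have "Z \<subseteq> C" using ZU by (auto simp: C_def saturation_def)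
    then have "measure lebesgue (cyl_part K A - C) \<le> measure lebesgue (cyl_part K A - Z)"
      using Z(3) \<open>closed C\<close> cyl_part_lebesgue[OF A]
      by (intro measure_mono_fmeasurable) (auto intro: sets.Diff)
    also have "\<dots> \<le> e"
      using Z(4) e by (simp add: measure_def enn2real_leI less_imp_le)
    finally show ?thesis .
  qed
  ultimately show ?thesis by blast
qed

lemma bkr_lebesgue:
  fixes A B :: "(real ^ 'n) set"
  assumes A: "A \<in> sets borel" "A \<subseteq> unit_cube" and B: "B \<in> sets borel" "B \<subseteq> unit_cube"
  shows "A \<box> B \<in> sets lebesgue"
    and "measure lebesgue (A \<box> B) \<le> measure lborel A * measure lborel B"
proof -
  show "A \<box> B \<in> sets lebesgue"
    unfolding bkr_def by (intro sets.finite_UN sets.Int cyl_part_lebesgue A B) simp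
  show "measure lebesgue (A \<box> B) \<le> measure lborel A * measure lborel B"
  proof (rule field_le_epsilon)
    fix e :: real assume "0 < e"
    define N where "N = real CARD('n set)"
    \<comment> \<open>There are \<open>N\<close> index sets \<open>K\<close>, each contributing one
      error for \<open>A\<close> and one for \<open>B\<close>.\<close>
    define d where "d = e / (2 * N)"
    have "0 < N" by (simp add: N_def card_gt_0_iff)
    then have d: "0 < d" "2 * (N * d) = e" using \<open>0 < e\<close> by (simp_all add: d_def)
    obtain C where C: "\<And>K. closed (C K)" "\<And>K. C K \<subseteq> cyl_part K A"
      "\<And>K x. x \<in> C K \<Longrightarrow> cyl K x \<subseteq> C K" "\<And>K. measure lebesgue (cyl_part K A - C K) \<le> d"
      using cyl_part_inner_closed[OF A d(1)] by metis
    obtain D where D: "\<And>K. closed (D K)" "\<And>K. D K \<subseteq> cyl_part (- K) B"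
      "\<And>K x. x \<in> D K \<Longrightarrow> cyl (- K) x \<subseteq> D K" "\<And>K. measure lebesgue (cyl_part (- K) B - D K) \<le> d"
      using cyl_part_inner_closed[OF B d(1), of "- _"] by metis
    have meas: "X \<in> lmeasurable" if "X \<in> sets lebesgue" "X \<subseteq> unit_cube" for X :: "(real ^ 'n) set"
      using that by (intro fmeasurableI2[OF lmeasurable_cbox[of 0 1]]) (simp_all add: unit_cube_eq_cbox)
    define R where "R = (\<Union>K. C K \<inter> D K)"
    define P where "P = (\<Union>K. cyl_part K A - C K)"
    define Q where "Q = (\<Union>K. cyl_part (- K) B - D K)"
    have CD: "C K \<subseteq> unit_cube" "D K \<subseteq> unit_cube" "C K \<subseteq> A" "D K \<subseteq> B" for K
      using C(2)[of K] D(2)[of K] cyl_part_subset by blast+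
    have diffs: "cyl_part K A - C K \<in> lmeasurable" "cyl_part (- K) B - D K \<in> lmeasurable" for K
      using cyl_part_lebesgue[OF A] cyl_part_lebesgue[OF B] C(1) D(1) cyl_part_subset(2)
      by (intro meas; blast intro: sets.Diff borel_closed sets_completionI_sets[of _ lborel, simplified])+
    have PQ: "P \<in> lmeasurable" "Q \<in> lmeasurable"
      unfolding P_def Q_def using diffs by (auto intro: fmeasurable.finite_UN)
    have bR: "closed R" unfolding R_def using C(1) D(1) by (intro closed_UN) auto
    then have R: "R \<in> lmeasurable"
      using CD by (intro meas) (auto simp: R_def)
    have P: "measure lebesgue P \<le> N * d"
    proof -
      have "measure lebesgue P \<le> (\<Sum>K\<in>UNIV. measure lebesgue (cyl_part K A - C K))"
        unfolding P_def using diffs by (intro measure_UNION_le) auto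
      also have "\<dots> \<le> (\<Sum>K\<in>(UNIV :: 'n set set). d)" by (intro sum_mono C)
      finally show ?thesis by (simp add: N_def)
    qed
    have Q: "measure lebesgue Q \<le> N * d"
    proof -
      have "measure lebesgue Q \<le> (\<Sum>K\<in>UNIV. measure lebesgue (cyl_part (- K) B - D K))"
        unfolding Q_def using diffs by (intro measure_UNION_le) auto
      also have "\<dots> \<le> (\<Sum>K\<in>(UNIV :: 'n set set). d)" by (intro sum_mono D)
      finally show ?thesis by (simp add: N_def)
    qed
    have bounded: "X \<in> fmeasurable lborel" if "X \<in> sets borel" "X \<subseteq> unit_cube"
      for X :: "(real ^ 'n) set"
      using that by (intro fmeasurableI2[OF fmeasurable_cbox[of 0 1]])
        (simp_all add: unit_cube_eq_cbox)
    have "measure lebesgue R = measure lborel R"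
      using bR by (simp add: measure_completion)
    also have "\<dots> \<le> measure lborel (\<Union>K. C K) * measure lborel (\<Union>K. D K)"
      unfolding R_def using C D CD by (intro bkr_closed_cylinders)
    also have "\<dots> \<le> measure lborel A * measure lborel B"
    proof (intro mult_mono measure_mono_fmeasurable bounded A B)
      show "(\<Union>K. C K) \<in> sets lborel" "(\<Union>K. D K) \<in> sets lborel"
        using C(1) D(1) by auto
      show "(\<Union>K. C K) \<subseteq> A" "(\<Union>K. D K) \<subseteq> B"
        by (auto dest: subsetD[OF CD(3)] subsetD[OF CD(4)])
    qed simp_all
    finally have R_le: "measure lebesgue R \<le> measure lborel A * measure lborel B" .
    \<comment> \<open>With the same \<open>K\<close> on both sides, a point missed by
      \<open>C K \<inter> D K\<close> lies in one of the two error sets for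
      \<open>K\<close>.\<close>
    have "A \<box> B \<subseteq> R \<union> (P \<union> Q)"
      unfolding bkr_def R_def P_def Q_def by blast
    then have "measure lebesgue (A \<box> B) \<le> measure lebesgue (R \<union> (P \<union> Q))"
      using R PQ \<open>A \<box> B \<in> sets lebesgue\<close> by (intro measure_mono_fmeasurable) auto
    also have "\<dots> \<le> measure lebesgue R + (measure lebesgue P + measure lebesgue Q)"
      using R PQ by (intro order_trans[OF measure_Un_le] add_left_mono measure_Un_le) auto
    also have "\<dots> \<le> measure lborel A * measure lborel B + e"
      using R_le P Q d(2) by simp
    finally show "measure lebesgue (A \<box> B) \<le> measure lborel A * measure lborel B + e" .
  qed
qed

section \<open>Transfer to the measure spaces on the cube\<close>

lemma emeasure_cube_borel:
  "X \<in> sets borel \<Longrightarrow> X \<subseteq> unit_cube \<Longrightarrow> emeasure cube_borel X = emeasure lborel X"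
  by (simp add: cube_borel_def emeasure_restrict_space)

text \<open>Completion commutes with restriction to the cube: in a splitting into a Borel set and
  part of a null set, the null set may be cut down to the cube.\<close>

lemma cube_lebesgue_eq_lebesgue:
  fixes X :: "(real ^ 'n) set"
  assumes "X \<in> sets lebesgue" "X \<subseteq> unit_cube"
  shows "X \<in> sets cube_lebesgue" and "emeasure cube_lebesgue X = emeasure lebesgue X"
proof -
  obtain S N N' where X: "X = S \<union> N" "N \<subseteq> N'" "N' \<in> null_sets lborel" "S \<in> sets lborel"
    using assms(1) by (rule sets_completionE)
  have S: "S \<in> sets borel" "S \<subseteq> unit_cube" using X assms by auto
  then have Sc: "S \<in> sets cube_borel"
    by (simp add: cube_borel_def sets_restrict_space_iff)
  have "N' \<inter> unit_cube \<in> null_sets lborel" using X(3) by (rule null_set_Int2) simp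
  then have Nc: "N' \<inter> unit_cube \<in> null_sets cube_borel"
    by (simp add: cube_borel_def null_sets_restrict_space)
  have N: "N \<subseteq> N' \<inter> unit_cube" using X assms by auto
  show "X \<in> sets cube_lebesgue"
    unfolding cube_lebesgue_def using X(1) N Nc Sc by (rule sets_completionI)
  have N0: "N \<in> null_sets cube_lebesgue" "N \<in> null_sets lebesgue"
    unfolding cube_lebesgue_def using N Nc X null_sets_completion_subset null_sets_completionI by blast+
  have "emeasure cube_lebesgue X = emeasure cube_borel S"
    using N0(1) Sc unfolding X(1) cube_lebesgue_def by (simp add: emeasure_Un_null_set)
  also have "\<dots> = emeasure lebesgue X"
    using N0(2) S unfolding X(1) by (simp add: emeasure_Un_null_set emeasure_cube_borel)
  finally show "emeasure cube_lebesgue X = emeasure lebesgue X" .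
qed

theorem theorem3:
  fixes A B :: "(real ^ 'n) set"
  assumes "A \<in> sets borel" and "A \<subseteq> unit_cube"
    and "B \<in> sets borel" and "B \<subseteq> unit_cube"
  shows "A \<box> B \<in> sets cube_lebesgue \<and>
    emeasure cube_lebesgue (A \<box> B) \<le> emeasure cube_borel A * emeasure cube_borel B"
proof
  have sub: "A \<box> B \<subseteq> unit_cube" using cyl_part_subset unfolding bkr_def by blast
  note bkr = bkr_lebesgue[OF assms]
  note cube = cube_lebesgue_eq_lebesgue[OF bkr(1) sub]
  show "A \<box> B \<in> sets cube_lebesgue" by (rule cube)
  have fin: "emeasure M X = ennreal (measure M X)"
    if "X \<in> sets M" "X \<subseteq> unit_cube" "M = lborel \<or> M = lebesgue" for X :: "(real ^ 'n) set" and M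
  proof (rule emeasure_eq_ennreal_measure)
    have "emeasure M X \<le> emeasure M unit_cube"
      using that by (intro emeasure_mono) auto
    also have "\<dots> < top"
      using that(3) by (auto simp: unit_cube_eq_cbox emeasure_lborel_cbox_eq)
    finally show "emeasure M X \<noteq> top" by simp
  qed
  have "emeasure cube_lebesgue (A \<box> B) = ennreal (measure lebesgue (A \<box> B))"
    using cube(2) fin[OF bkr(1) sub] by simp
  also have "\<dots> \<le> ennreal (measure lborel A * measure lborel B)"
    by (intro ennreal_leI bkr(2))
  also have "\<dots> = emeasure cube_borel A * emeasure cube_borel B"
    using assms fin[of A lborel] fin[of B lborel] by (simp add: emeasure_cube_borel ennreal_mult)
  finally show "emeasure cube_lebesgue (A \<box> B) \<le> emeasure cube_borel A * emeasure cube_borel B" .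
qed

end
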